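(* Let $n$ be a positive integer. For every subset $A\subset[n]=\{1,\dots,n\}$, the intermediate Casimir element $C_A\in U(\mathfrak{osp}(1|2))^{\otimes n}$ belongs to the centralizer of the diagonal action of $\mathfrak{osp}(1|2)$; that is, $[\Delta^{(n-1)}(x),C_A]=0$ for all $x\in\mathfrak{osp}(1|2)$.
   Context: Work over $\mathbb{C}$. $[X,Y]=XY-YX$ and $\{X,Y\}=XY+YX$. $U=U(\mathfrak{osp}(1|2))$ denotes the unital associative algebra generated by the generators $F^\pm,H,E^\pm$ of $\mathfrak{osp}(1|2)$ and a grading involution $P$ with relations $[H,E^\pm]=\pm E^\pm$, $[E^+,E^-]=2H$, $[H,F^\pm]=\pm\frac12F^\pm$, $\{F^+,F^-\}=\frac12H$, $[E^\pm,F^\mp]=-F^\pm$, $\{F^\pm,F^\pm\}=\pm\frac12E^\pm$, $[P,E^\pm]=0$, $[P,H]=0$, $\{P,F^\pm\}=0$, $P^2=1$. Tensor powers of $U$ carry the ordinary (ungraded) componentwise product. The coproduct $\Delta:U\to U\otimes U$ is the (coassociative) algebra homomorphism with $\Delta(E^\pm)=E^\pm\otimes1+1\otimes E^\pm$, $\Delta(H)=H\otimes1+1\otimes H$, $\Delta(F^\pm)=F^\pm\otimes P+1\otimes F^\pm$, $\Delta(P)=P\otimes P$. Set $\Delta^{(0)}=\mathrm{id}$ and $\Delta^{(k)}=(\mathrm{id}\otimes\Delta^{(k-1)})\Delta$. The Casimir element is $C=8[F^+,F^-]P+P$, which is central in $U$. The universal $R$-matrix is $\mathcal{R}=\frac12(1\otimes1+P\otimes1+1\otimes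 P-P\otimes P)$, with $\mathcal R^{-1}=\mathcal R$; $\mathcal{R}_{i,j}$ denotes $\mathcal R$ placed in factors $i$ and $j$ of $U^{\otimes n}$. Let $\sigma_{i,i+1}$ be the operator exchanging factors $i$ and $i+1$, i.e. $\sigma_{i,i+1}X\sigma_{i,i+1}^{-1}$ is $X$ with tensor factors $i$ and $i+1$ interchanged. Put $\check{\mathcal R}_i=\mathcal R_{i,i+1}\sigma_{i,i+1}$. Let $s_i\in\mathfrak S_n$ be the transposition $(i\ i{+}1)$, with permutations composed from right to left. For $s=s_{i_1}\cdots s_{i_p}\in\mathfrak S_n$ and $X\in U^{\otimes n}$, put $\gamma_s(X)=\check{\mathcal R}_{i_1}\cdots\check{\mathcal R}_{i_p}\,X\,(\check{\mathcal R}_{i_1}\cdots\check{\mathcal R}_{i_p})^{-1}$; this does not depend on the chosen decomposition of $s$. For $1\le k\le\ell\le n$ and $K=\{k,k+1,\dots,\ell\}$, put $C_K=1^{\otimes(k-1)}\otimes\Delta^{(\ell-k)}(C)\otimes1^{\otimes(n-\ell)}$. For an arbitrary nonempty $A\subset[n]$, put $C_A=\gamma_s(C_K)$, where $K\subset[n]$ is a set of consecutive integers with $|K|=|A|$ and $s\in\mathfrak S_n$ satisfies $s(K)=A$; the result does not depend on the choice of $K$ and $s$. Put $C_\emptyset=1$. *)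

theory Defs
  imports Complex_Main "HOL-Library.Poly_Mapping" "HOL-Combinatorics.Permutations"
begin

section \<open>Free algebras and free vector spaces\<close>

text \<open>Lists form the free monoid, so that the convolution product of
  \<^typ>\<open>'a list \<Rightarrow>\<^sub>0 complex\<close> is the product of the free unital associative algebra on \<^typ>\<open>'a\<close>.\<close>

instantiation list :: (type) monoid_add
begin
definition zero_list :: "'a list" where "zero_list = []"
definition plus_list :: "'a list \<Rightarrow> 'a list \<Rightarrow> 'a list" where "plus_list xs ys = xs @ ys"
instance by standard (simp_all add: zero_list_def plus_list_def)
end

definition fscale :: "complex \<Rightarrow> ('a \<Rightarrow>\<^sub>0 complex) \<Rightarrow> ('a \<Rightarrow>\<^sub>0 complex)" where
  "fscale c = Poly_Mapping.map ((*) c)"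

lemma lookup_fscale [simp]: "Poly_Mapping.lookup (fscale c p) k = c * Poly_Mapping.lookup p k"
  unfolding fscale_def by transfer (simp add: when_def)

interpretation fv: vector_space "fscale :: complex \<Rightarrow> ('a \<Rightarrow>\<^sub>0 complex) \<Rightarrow> _"
  by standard (auto intro!: poly_mapping_eqI simp: lookup_add algebra_simps)

lemma fscale_single [simp]: "fscale c (Poly_Mapping.single k d) = Poly_Mapping.single k (c * d)"
  by (auto intro!: poly_mapping_eqI simp: lookup_single when_def)

lemma free_expand: "p = (\<Sum>k\<in>Poly_Mapping.keys p. Poly_Mapping.single k (Poly_Mapping.lookup p k))"
  by (rule poly_mapping_eqI) (auto simp: lookup_sum lookup_single when_def in_keys_iff sum.delta)

lemma free_induct [case_names single add]:
  assumes "\<And>k c. P (Poly_Mapping.single k (c::complex))" "\<And>p q. P p \<Longrightarrow> P q \<Longrightarrow> P (p + q)"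
  shows "P (p :: 'a \<Rightarrow>\<^sub>0 complex)"
proof -
  have z: "P 0" using assms(1)[of undefined 0] by simp
  have "finite A \<Longrightarrow> P (\<Sum>k\<in>A. Poly_Mapping.single k (Poly_Mapping.lookup p k))" for A
    by (induction A rule: finite_induct) (auto simp: z assms)
  from this[OF finite_keys] show ?thesis by (subst free_expand)
qed

lemma fscale_mult_left: "fscale c (p::'a list \<Rightarrow>\<^sub>0 complex) * q = fscale c (p * q)"
proof (induction p rule: free_induct)
  case (single k d)
  show ?case
    by (induction q rule: free_induct)
       (simp_all add: mult_single distrib_left fv.scale_right_distrib mult.assoc)
qed (simp add: distrib_right fv.scale_right_distrib)

lemma fscale_mult_right: "(p::'a list \<Rightarrow>\<^sub>0 complex) * fscale c q = fscale c (p * q)"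
proof (induction p rule: free_induct)
  case (single k d)
  show ?case
    by (induction q rule: free_induct)
       (simp_all add: mult_single distrib_left fv.scale_right_distrib mult.left_commute)
qed (simp add: distrib_right fv.scale_right_distrib)


definition linext :: "(complex \<Rightarrow> 'b \<Rightarrow> 'b) \<Rightarrow> ('a \<Rightarrow> 'b::ab_group_add) \<Rightarrow> ('a \<Rightarrow>\<^sub>0 complex) \<Rightarrow> 'b" where
  "linext s \<phi> p = (\<Sum>k\<in>Poly_Mapping.keys p. s (Poly_Mapping.lookup p k) (\<phi> k))"

context
  fixes s :: "complex \<Rightarrow> 'b \<Rightarrow> 'b::ab_group_add"
  assumes s: "vector_space s"
begin

interpretation vs: vector_space s by (rule s)

lemma linext_superset:
  "finite A \<Longrightarrow> Poly_Mapping.keys p \<subseteq> A \<Longrightarrow> linext s \<phi> p = (\<Sum>k\<in>A. s (Poly_Mapping.lookup p k) (\<phi> k))"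
  unfolding linext_def by (rule sum.mono_neutral_left) (auto simp: in_keys_iff)

lemma linext_single: "linext s \<phi> (Poly_Mapping.single k c) = s c (\<phi> k)"
  by (simp add: linext_superset[of "{k}"])

lemma linext_add: "linext s \<phi> (p + q) = linext s \<phi> p + linext s \<phi> q"
proof -
  let ?A = "Poly_Mapping.keys p \<union> Poly_Mapping.keys q"
  have "linext s \<phi> (p + q) = (\<Sum>k\<in>?A. s (Poly_Mapping.lookup (p + q) k) (\<phi> k))"
    by (rule linext_superset) (use keys_add[of p q] in auto)
  also have "\<dots> = (\<Sum>k\<in>?A. s (Poly_Mapping.lookup p k) (\<phi> k)) + (\<Sum>k\<in>?A. s (Poly_Mapping.lookup q k) (\<phi> k))"
    by (simp add: lookup_add vs.scale_left_distrib sum.distrib)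
  also have "\<dots> = linext s \<phi> p + linext s \<phi> q"
    by (simp add: linext_superset[of ?A])
  finally show ?thesis .
qed

lemma linext_fscale: "linext s \<phi> (fscale c p) = s c (linext s \<phi> p)"
proof -
  have "linext s \<phi> (fscale c p) = (\<Sum>k\<in>Poly_Mapping.keys p. s (Poly_Mapping.lookup (fscale c p) k) (\<phi> k))"
    by (rule linext_superset) (auto simp: in_keys_iff)
  then show ?thesis by (simp add: linext_def vs.scale_sum_right)
qed

lemma linext_zero: "linext s \<phi> 0 = 0"
  by (simp add: linext_def)

lemma linext_minus: "linext s \<phi> (- p) = - linext s \<phi> p"
  using linext_add[of \<phi> p "- p"] by (simp add: linext_zero eq_neg_iff_add_eq_0 add.commute)

lemma linext_diff: "linext s \<phi> (p - q) = linext s \<phi> p - linext s \<phi> q"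
  using linext_add[of \<phi> p "- q"] by (simp add: linext_minus)

lemma linext_fun_add: "linext s (\<lambda>k. \<phi> k + \<psi> k) p = linext s \<phi> p + linext s \<psi> p"
  by (simp add: linext_def vs.scale_right_distrib sum.distrib)

lemma linext_fun_scale: "linext s (\<lambda>k. s c (\<phi> k)) p = s c (linext s \<phi> p)"
  by (simp add: linext_def vs.scale_sum_right mult.commute)

end


section \<open>The algebra \<open>U(osp(1|2))\<close>\<close>

definition commutator :: "'a::ring \<Rightarrow> 'a \<Rightarrow> 'a" where
  "commutator X Y = X * Y - Y * X"

definition anticommutator :: "'a::ring \<Rightarrow> 'a \<Rightarrow> 'a" where
  "anticommutator X Y = X * Y + Y * X"

datatype gen = gFp | gFm | gH | gEp | gEm | gP

definition fgen :: "gen \<Rightarrow> (gen list \<Rightarrow>\<^sub>0 complex)" where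
  "fgen g = Poly_Mapping.single [g] 1"

definition osp_relators :: "(gen list \<Rightarrow>\<^sub>0 complex) set" where
  "osp_relators =
    {commutator (fgen gH) (fgen gEp) - fgen gEp,
     commutator (fgen gH) (fgen gEm) + fgen gEm,
     commutator (fgen gEp) (fgen gEm) - fscale 2 (fgen gH),
     commutator (fgen gH) (fgen gFp) - fscale (1/2) (fgen gFp),
     commutator (fgen gH) (fgen gFm) + fscale (1/2) (fgen gFm),
     anticommutator (fgen gFp) (fgen gFm) - fscale (1/2) (fgen gH),
     commutator (fgen gEp) (fgen gFm) + fgen gFp,
     commutator (fgen gEm) (fgen gFp) + fgen gFm,
     anticommutator (fgen gFp) (fgen gFp) - fscale (1/2) (fgen gEp),
     anticommutator (fgen gFm) (fgen gFm) + fscale (1/2) (fgen gEm),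
     commutator (fgen gP) (fgen gEp),
     commutator (fgen gP) (fgen gEm),
     commutator (fgen gP) (fgen gH),
     anticommutator (fgen gP) (fgen gFp),
     anticommutator (fgen gP) (fgen gFm),
     fgen gP * fgen gP - 1}"

definition osp_ideal :: "(gen list \<Rightarrow>\<^sub>0 complex) set" where
  "osp_ideal = fv.span {a * r * b | a r b. r \<in> osp_relators}"

lemma osp_ideal_add: "x \<in> osp_ideal \<Longrightarrow> y \<in> osp_ideal \<Longrightarrow> x + y \<in> osp_ideal"
  and osp_ideal_diff: "x \<in> osp_ideal \<Longrightarrow> y \<in> osp_ideal \<Longrightarrow> x - y \<in> osp_ideal"
  and osp_ideal_neg: "x \<in> osp_ideal \<Longrightarrow> - x \<in> osp_ideal"
  and osp_ideal_scale: "x \<in> osp_ideal \<Longrightarrow> fscale c x \<in> osp_ideal"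
  and osp_ideal_zero: "0 \<in> osp_ideal"
  unfolding osp_ideal_def
  by (rule fv.span_add fv.span_diff fv.span_neg fv.span_scale fv.span_zero; assumption)+

lemma osp_ideal_mult_left: "x \<in> osp_ideal \<Longrightarrow> y * x \<in> osp_ideal"
  unfolding osp_ideal_def
proof (induction x rule: fv.span_induct_alt)
  case (step c x z)
  from step(1) obtain a r b where "x = a * r * b" "r \<in> osp_relators" by blast
  then have "y * x = (y * a) * r * b" by (simp add: mult.assoc)
  then have "y * x \<in> {a * r * b | a r b. r \<in> osp_relators}" using \<open>r \<in> osp_relators\<close> by blast
  then show ?case using step(2)
    by (simp add: distrib_left fscale_mult_right fv.span_add fv.span_scale fv.span_base)
qed (simp add: fv.span_zero)

lemma osp_ideal_mult_right: "x \<in> osp_ideal \<Longrightarrow> x * y \<in> osp_ideal"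
  unfolding osp_ideal_def
proof (induction x rule: fv.span_induct_alt)
  case (step c x z)
  from step(1) obtain a r b where "x = a * r * b" "r \<in> osp_relators" by blast
  then have "x * y = a * r * (b * y)" by (simp add: mult.assoc)
  then have "x * y \<in> {a * r * b | a r b. r \<in> osp_relators}" using \<open>r \<in> osp_relators\<close> by blast
  then show ?case using step(2)
    by (simp add: distrib_right fscale_mult_left fv.span_add fv.span_scale fv.span_base)
qed (simp add: fv.span_zero)

lemma osp_relators_ideal: "r \<in> osp_relators \<Longrightarrow> r \<in> osp_ideal"
  unfolding osp_ideal_def 
  by (rule fv.span_base, rule CollectI) (metis mult_1 mult_1_right)

text \<open>The character \<open>P \<mapsto> 1\<close>, \<open>F\<^sup>\<plusminus>, H, E\<^sup>\<plusminus> \<mapsto> 0\<close> shows that the ideal is proper.\<close>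

lemma one_notin_osp_ideal: "1 \<notin> osp_ideal"
proof -
  define \<phi> where "\<phi> w = (if set w \<subseteq> {gP} then 1 else 0 :: complex)" for w
  let ?e = "linext (*) \<phi>"
  have vs: "vector_space ((*) :: complex \<Rightarrow> _)"
    by standard (auto simp: algebra_simps)
  note lin = linext_add[OF vs] linext_diff[OF vs] linext_fscale[OF vs] linext_single[OF vs]
  have mult: "?e (p * q) = ?e p * ?e q" for p q
  proof (induction p rule: free_induct)
    case (single k c)
    show ?case
      by (induction q rule: free_induct)
         (auto simp: lin mult_single distrib_left \<phi>_def plus_list_def)
  qed (simp add: lin distrib_right)
  have one: "?e 1 = 1"
  proof -
    have "set (0 :: gen list) \<subseteq> {gP}" by (simp add: zero_list_def)
    then show ?thesis using lin(4)[of \<phi> 0 1] by (simp add: \<phi>_def)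
  qed
  have rel: "?e r = 0" if "r \<in> osp_relators" for r
    using that unfolding osp_relators_def
    by (auto simp: commutator_def anticommutator_def lin mult one fgen_def \<phi>_def)
  have "?e x = 0" if "x \<in> osp_ideal" for x
    using that unfolding osp_ideal_def
    by (induction x rule: fv.span_induct_alt) (auto simp: lin mult rel linext_zero[OF vs])
  with one show ?thesis by force
qed

definition osp_rel :: "(gen list \<Rightarrow>\<^sub>0 complex) \<Rightarrow> (gen list \<Rightarrow>\<^sub>0 complex) \<Rightarrow> bool" where
  "osp_rel p q \<longleftrightarrow> p - q \<in> osp_ideal"

quotient_type U = "gen list \<Rightarrow>\<^sub>0 complex" / osp_rel
proof (rule equivpI)
  show "reflp osp_rel" by (simp add: reflp_def osp_rel_def osp_ideal_zero)
  show "symp osp_rel"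
  proof (rule sympI)
    fix p q assume "osp_rel p q"
    then have "- (p - q) \<in> osp_ideal" unfolding osp_rel_def by (rule osp_ideal_neg)
    then show "osp_rel q p" by (simp add: osp_rel_def)
  qed
  show "transp osp_rel"
  proof (rule transpI)
    fix p q r assume "osp_rel p q" "osp_rel q r"
    then have "(p - q) + (q - r) \<in> osp_ideal" unfolding osp_rel_def by (rule osp_ideal_add)
    then show "osp_rel p r" by (simp add: osp_rel_def)
  qed
qed

instantiation U :: ring_1
begin
lift_definition zero_U :: U is 0 .
lift_definition one_U :: U is 1 .
lift_definition plus_U :: "U \<Rightarrow> U \<Rightarrow> U" is "(+)"
  unfolding osp_rel_def by (simp only: add_diff_add osp_ideal_add)
lift_definition uminus_U :: "U \<Rightarrow> U" is uminus
  unfolding osp_rel_def by (simp only: minus_diff_minus osp_ideal_neg)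
lift_definition minus_U :: "U \<Rightarrow> U \<Rightarrow> U" is "(-)"
proof -
  fix p p' q q' :: "gen list \<Rightarrow>\<^sub>0 complex"
  assume "osp_rel p p'" "osp_rel q q'"
  then have "(p - p') - (q - q') \<in> osp_ideal"
    unfolding osp_rel_def by (rule osp_ideal_diff)
  then show "osp_rel (p - q) (p' - q')" by (simp add: osp_rel_def algebra_simps)
qed
lift_definition times_U :: "U \<Rightarrow> U \<Rightarrow> U" is "(*)"
proof -
  fix p p' q q' :: "gen list \<Rightarrow>\<^sub>0 complex"
  assume "osp_rel p p'" "osp_rel q q'"
  then have "(p - p') * q + p' * (q - q') \<in> osp_ideal"
    unfolding osp_rel_def by (intro osp_ideal_add osp_ideal_mult_left osp_ideal_mult_right)
  then show "osp_rel (p * q) (p' * q')" by (simp add: osp_rel_def algebra_simps)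
qed
lemma osp_rel_refl: "p = q \<Longrightarrow> osp_rel p q"
  by (simp add: osp_rel_def osp_ideal_zero)
instance
proof
  show "(0::U) \<noteq> 1"
    by transfer (use one_notin_osp_ideal osp_ideal_neg in \<open>force simp: osp_rel_def\<close>)
qed (transfer; rule osp_rel_refl; simp add: algebra_simps)+
end

lift_definition uscale :: "complex \<Rightarrow> U \<Rightarrow> U" is fscale
  unfolding osp_rel_def by (metis fv.scale_right_diff_distrib osp_ideal_scale)

interpretation uv: vector_space uscale
  by standard (transfer; rule osp_rel_refl; simp add: fv.scale_left_distrib fv.scale_right_distrib)+

lemma uscale_mult_left: "uscale c a * b = uscale c (a * b)"
  by transfer (simp add: osp_rel_refl fscale_mult_left)

lemma uscale_mult_right: "a * uscale c b = uscale c (a * b)"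
  by transfer (simp add: osp_rel_refl fscale_mult_right)

lift_definition ugen :: "gen \<Rightarrow> U" is fgen .

abbreviation "uFp \<equiv> ugen gFp"
abbreviation "uFm \<equiv> ugen gFm"
abbreviation "uH \<equiv> ugen gH"
abbreviation "uEp \<equiv> ugen gEp"
abbreviation "uEm \<equiv> ugen gEm"
abbreviation "uP \<equiv> ugen gP"

lemma U_relations:
  "commutator uH uEp = uEp"
  "commutator uH uEm = - uEm"
  "commutator uEp uEm = uscale 2 uH"
  "commutator uH uFp = uscale (1/2) uFp"
  "commutator uH uFm = - uscale (1/2) uFm"
  "anticommutator uFp uFm = uscale (1/2) uH"
  "commutator uEp uFm = - uFp"
  "commutator uEm uFp = - uFm"
  "anticommutator uFp uFp = uscale (1/2) uEp"
  "anticommutator uFm uFm = - uscale (1/2) uEm"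
  "commutator uP uEp = 0"
  "commutator uP uEm = 0"
  "commutator uP uH = 0"
  "anticommutator uP uFp = 0"
  "anticommutator uP uFm = 0"
  "uP * uP = 1"
  unfolding commutator_def anticommutator_def
  by (transfer; simp add: osp_rel_def; rule osp_relators_ideal;
      simp add: osp_relators_def commutator_def anticommutator_def)+

definition osp12 :: "U set" where
  "osp12 = uv.span {uFp, uFm, uH, uEp, uEm}"

definition casimir :: U where
  "casimir = 8 * commutator uFp uFm * uP + uP"


section \<open>Tensor powers\<close>

text \<open>The type \<open>tens\<close> is the direct sum of all tensor powers of \<^typ>\<open>U\<close>: the free vector space on
  tuples (lists) of elements of \<^typ>\<open>U\<close> modulo multilinearity. The summand of degree \<open>n\<close> is
  \<open>tpow n\<close> below.\<close>

definition tens_relators :: "(U list \<Rightarrow>\<^sub>0 complex) set" where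
  "tens_relators =
    {Poly_Mapping.single (xs @ (a + b) # ys) 1 - Poly_Mapping.single (xs @ a # ys) 1
       - Poly_Mapping.single (xs @ b # ys) 1 | xs a b ys. True} \<union>
    {Poly_Mapping.single (xs @ uscale c a # ys) 1 - Poly_Mapping.single (xs @ a # ys) c | xs c a ys. True}"

definition tens_rel :: "(U list \<Rightarrow>\<^sub>0 complex) \<Rightarrow> (U list \<Rightarrow>\<^sub>0 complex) \<Rightarrow> bool" where
  "tens_rel p q \<longleftrightarrow> p - q \<in> fv.span tens_relators"

quotient_type tens = "U list \<Rightarrow>\<^sub>0 complex" / tens_rel
proof (rule equivpI)
  show "reflp tens_rel" by (simp add: reflp_def tens_rel_def fv.span_zero)
  show "symp tens_rel"
  proof (rule sympI)
    fix p q assume "tens_rel p q"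
    then have "- (p - q) \<in> fv.span tens_relators" unfolding tens_rel_def by (rule fv.span_neg)
    then show "tens_rel q p" by (simp add: tens_rel_def)
  qed
  show "transp tens_rel"
  proof (rule transpI)
    fix p q r assume "tens_rel p q" "tens_rel q r"
    then have "(p - q) + (q - r) \<in> fv.span tens_relators" unfolding tens_rel_def by (rule fv.span_add)
    then show "tens_rel p r" by (simp add: tens_rel_def)
  qed
qed

lemma tens_rel_refl: "p = q \<Longrightarrow> tens_rel p q"
  by (simp add: tens_rel_def fv.span_zero)

instantiation tens :: ab_group_add
begin
lift_definition zero_tens :: tens is 0 .
lift_definition plus_tens :: "tens \<Rightarrow> tens \<Rightarrow> tens" is "(+)"
  unfolding tens_rel_def by (simp only: add_diff_add fv.span_add)
lift_definition uminus_tens :: "tens \<Rightarrow> tens" is uminus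
  unfolding tens_rel_def by (simp only: minus_diff_minus fv.span_neg)
lift_definition minus_tens :: "tens \<Rightarrow> tens \<Rightarrow> tens" is "(-)"
proof -
  fix p p' q q' :: "U list \<Rightarrow>\<^sub>0 complex"
  assume "tens_rel p p'" "tens_rel q q'"
  then have "(p - p') - (q - q') \<in> fv.span tens_relators"
    unfolding tens_rel_def by (rule fv.span_diff)
  then show "tens_rel (p - q) (p' - q')" by (simp add: tens_rel_def algebra_simps)
qed
instance by standard (transfer; rule tens_rel_refl; simp)+
end

lift_definition tscale :: "complex \<Rightarrow> tens \<Rightarrow> tens" is fscale
  by (simp add: tens_rel_def fv.span_scale flip: fv.scale_right_diff_distrib)

interpretation tv: vector_space tscale
  by standard (transfer; rule tens_rel_refl; simp add: fv.scale_left_distrib fv.scale_right_distrib)+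

definition pure :: "U list \<Rightarrow> tens" where
  "pure xs = abs_tens (Poly_Mapping.single xs 1)"

definition tpow :: "nat \<Rightarrow> tens set" where
  "tpow n = tv.span {pure xs | xs. length xs = n}"

lemma pure_in_tpow: "length xs = n \<Longrightarrow> pure xs \<in> tpow n"
  unfolding tpow_def by (rule tv.span_base) blast

definition multilinear :: "(U list \<Rightarrow> tens) \<Rightarrow> bool" where
  "multilinear \<phi> \<longleftrightarrow>
    (\<forall>xs a b ys. \<phi> (xs @ (a + b) # ys) = \<phi> (xs @ a # ys) + \<phi> (xs @ b # ys)) \<and>
    (\<forall>xs c a ys. \<phi> (xs @ uscale c a # ys) = tscale c (\<phi> (xs @ a # ys)))"

lemmas tlinext = linext_add[OF tv.vector_space_axioms] linext_diff[OF tv.vector_space_axioms]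
  linext_minus[OF tv.vector_space_axioms] linext_zero[OF tv.vector_space_axioms]
  linext_fscale[OF tv.vector_space_axioms] linext_single[OF tv.vector_space_axioms]

lemma multilinear_pure: "multilinear pure"
  unfolding multilinear_def
proof (intro conjI allI)
  fix xs ys :: "U list" and a b :: U and c :: complex
  have "Poly_Mapping.single (xs @ (a + b) # ys) 1 - Poly_Mapping.single (xs @ a # ys) 1
          - Poly_Mapping.single (xs @ b # ys) 1 \<in> tens_relators"
    unfolding tens_relators_def by blast
  then have "tens_rel (Poly_Mapping.single (xs @ (a + b) # ys) 1)
          (Poly_Mapping.single (xs @ a # ys) 1 + Poly_Mapping.single (xs @ b # ys) 1)"
    by (simp add: tens_rel_def diff_diff_eq[symmetric] fv.span_base)
  then show "pure (xs @ (a + b) # ys) = pure (xs @ a # ys) + pure (xs @ b # ys)"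
    by (simp add: pure_def plus_tens.abs_eq tens.abs_eq_iff)
  have "Poly_Mapping.single (xs @ uscale c a # ys) 1 - Poly_Mapping.single (xs @ a # ys) c
          \<in> tens_relators"
    unfolding tens_relators_def by blast
  then have "tens_rel (Poly_Mapping.single (xs @ uscale c a # ys) 1) (Poly_Mapping.single (xs @ a # ys) c)"
    by (simp add: tens_rel_def fv.span_base)
  then show "pure (xs @ uscale c a # ys) = tscale c (pure (xs @ a # ys))"
    by (simp add: pure_def tscale.abs_eq tens.abs_eq_iff)
qed

text \<open>The universal property of the tensor powers. The representative chosen does not matter by
  \<open>tlift_abs\<close>; the value for a non-multilinear argument is irrelevant.\<close>

definition tlift :: "(U list \<Rightarrow> tens) \<Rightarrow> tens \<Rightarrow> tens" where
  "tlift \<phi> x = (if multilinear \<phi> then linext tscale \<phi> (rep_tens x) else 0)"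

lemma tlift_abs:
  assumes "multilinear \<phi>"
  shows "tlift \<phi> (abs_tens p) = linext tscale \<phi> p"
proof -
  have "linext tscale \<phi> x = 0" if "x \<in> fv.span tens_relators" for x
    using that
  proof (induction x rule: fv.span_induct_alt)
    case (step c x z)
    then have "linext tscale \<phi> x = 0"
      using assms unfolding tens_relators_def multilinear_def by (auto simp: tlinext)
    with step show ?case by (simp add: tlinext)
  qed (simp add: tlinext)
  moreover have "tens_rel (rep_tens (abs_tens p)) p"
    by (rule Quotient3_rep_abs[OF Quotient3_tens]) (simp add: tens_rel_refl)
  ultimately have "linext tscale \<phi> (rep_tens (abs_tens p) - p) = 0"
    by (simp add: tens_rel_def)
  then show ?thesis
    using assms by (simp add: tlift_def tlinext)
qed

lemma tens_abs_cases: obtains p where "x = abs_tens p"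
  using that[of "rep_tens x"] Quotient3_abs_rep[OF Quotient3_tens, of x] by simp

lemma tlift_pure [simp]: "multilinear \<phi> \<Longrightarrow> tlift \<phi> (pure xs) = \<phi> xs"
  by (simp add: pure_def tlift_abs tlinext)

lemma tlift_add: "tlift \<phi> (x + y) = tlift \<phi> x + tlift \<phi> y"
proof (cases "multilinear \<phi>")
  case True
  obtain p where "x = abs_tens p" by (rule tens_abs_cases)
  moreover obtain q where "y = abs_tens q" by (rule tens_abs_cases)
  ultimately show ?thesis using True by (simp add: plus_tens.abs_eq tlift_abs tlinext)
qed (simp add: tlift_def)

lemma tlift_scale: "tlift \<phi> (tscale c x) = tscale c (tlift \<phi> x)"
proof (cases "multilinear \<phi>")
  case True
  obtain p where "x = abs_tens p" by (rule tens_abs_cases)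
  with True show ?thesis by (simp add: tscale.abs_eq tlift_abs tlinext)
qed (simp add: tlift_def)

lemma tens_induct [case_names pure add scale]:
  assumes "\<And>xs. Q (pure xs)" "\<And>x y. Q x \<Longrightarrow> Q y \<Longrightarrow> Q (x + y)"
    "\<And>c x. Q x \<Longrightarrow> Q (tscale c x)"
  shows "Q x"
proof -
  have "Q (abs_tens p)" for p
  proof (induction p rule: free_induct)
    case (single xs c)
    have "abs_tens (Poly_Mapping.single xs c) = tscale c (pure xs)"
      by (simp add: pure_def tscale.abs_eq)
    then show ?case using assms by simp
  next
    case (add p q)
    then show ?case using assms(2) by (simp add: plus_tens.abs_eq[symmetric])
  qed
  then show ?thesis using tens_abs_cases[of x] by metis
qed

lemma tlift_zero [simp]: "tlift \<phi> 0 = 0"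
  using tlift_scale[of \<phi> 0 0] by simp

lemma tlift_fun_add:
  "multilinear \<phi> \<Longrightarrow> multilinear \<psi> \<Longrightarrow> multilinear (\<lambda>xs. \<phi> xs + \<psi> xs) \<Longrightarrow>
    tlift (\<lambda>xs. \<phi> xs + \<psi> xs) x = tlift \<phi> x + tlift \<psi> x"
  by (induction x rule: tens_induct) (simp_all add: tlift_add tlift_scale tv.scale_right_distrib)

lemma multilinear_add:
  "multilinear \<phi> \<Longrightarrow> multilinear \<psi> \<Longrightarrow> multilinear (\<lambda>xs. \<phi> xs + \<psi> xs)"
  by (simp add: multilinear_def tv.scale_right_distrib)

lemma multilinear_scale:
  "multilinear \<phi> \<Longrightarrow> multilinear (\<lambda>xs. tscale c (\<phi> xs))"
  by (simp add: multilinear_def tv.scale_right_distrib mult.commute)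

lemma multilinear_tlift:
  assumes "\<And>ys. multilinear (\<lambda>xs. f xs ys)" "\<And>xs. multilinear (f xs)"
  shows "multilinear (\<lambda>xs. tlift (f xs) y)"
proof (induction y rule: tens_induct)
  case (pure ys)
  then show ?case by (simp add: assms)
next
  case (add x y)
  then show ?case by (simp add: tlift_add multilinear_add)
next
  case (scale c x)
  then show ?case by (simp add: tlift_scale multilinear_scale)
qed

lemma pure_add: "pure (xs @ (a + b) # ys) = pure (xs @ a # ys) + pure (xs @ b # ys)"
  and pure_scale: "pure (xs @ uscale c a # ys) = tscale c (pure (xs @ a # ys))"
  using multilinear_pure by (simp_all add: multilinear_def)

lemma length_eq_split:
  assumes "length zs = length (xs @ a # ys)"
  obtains us b vs where "zs = us @ b # vs" "length us = length xs" "length vs = length ys"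
proof -
  have "length xs < length zs" using assms by simp
  then have "zs = take (length xs) zs @ zs ! length xs # drop (Suc (length xs)) zs"
    by (rule id_take_nth_drop)
  with that[of "take (length xs) zs" "zs ! length xs" "drop (Suc (length xs)) zs"] assms
  show thesis by simp
qed


subsection \<open>Componentwise product and juxtaposition\<close>

text \<open>The componentwise product of pure tensors of different degrees is set to zero.\<close>

definition pure_mult :: "U list \<Rightarrow> U list \<Rightarrow> tens" where
  "pure_mult xs ys = (if length xs = length ys then pure (map2 (*) xs ys) else 0)"

lemma multilinear_pure_mult: "multilinear (pure_mult xs)" "multilinear (\<lambda>xs. pure_mult xs ys)"
proof -
  show "multilinear (pure_mult xs)"
    unfolding multilinear_def
  proof (intro conjI allI)
    fix us vs a b c
    show "pure_mult xs (us @ (a + b) # vs) = pure_mult xs (us @ a # vs) + pure_mult xs (us @ b # vs)"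
      "pure_mult xs (us @ uscale c a # vs) = tscale c (pure_mult xs (us @ a # vs))"
      by (cases "length xs = length (us @ a # vs)"; (elim length_eq_split)?;
          simp add: pure_mult_def distrib_left pure_add uscale_mult_right pure_scale)+
  qed
  show "multilinear (\<lambda>xs. pure_mult xs ys)"
    unfolding multilinear_def
  proof (intro conjI allI)
    fix us vs a b c
    show "pure_mult (us @ (a + b) # vs) ys = pure_mult (us @ a # vs) ys + pure_mult (us @ b # vs) ys"
      "pure_mult (us @ uscale c a # vs) ys = tscale c (pure_mult (us @ a # vs) ys)"
      by (cases "length ys = length (us @ a # vs)"; (elim length_eq_split)?;
          simp add: pure_mult_def distrib_right pure_add uscale_mult_left pure_scale)+
  qed
qed

definition tlift2 :: "(U list \<Rightarrow> U list \<Rightarrow> tens) \<Rightarrow> tens \<Rightarrow> tens \<Rightarrow> tens" where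
  "tlift2 f x y = tlift (\<lambda>xs. tlift (f xs) y) x"

lemma tlift2:
  assumes "\<And>ys. multilinear (\<lambda>xs. f xs ys)" "\<And>xs. multilinear (f xs)"
  shows "tlift2 f (pure xs) (pure ys) = f xs ys"
    and "tlift2 f (x + x') y = tlift2 f x y + tlift2 f x' y"
    and "tlift2 f x (y + y') = tlift2 f x y + tlift2 f x y'"
    and "tlift2 f (tscale c x) y = tscale c (tlift2 f x y)"
    and "tlift2 f x (tscale c y) = tscale c (tlift2 f x y)"
proof -
  note m = multilinear_tlift[of f, OF assms]
  show "tlift2 f (pure xs) (pure ys) = f xs ys"
    by (simp add: tlift2_def m assms)
  show "tlift2 f (x + x') y = tlift2 f x y + tlift2 f x' y"
    and "tlift2 f (tscale c x) y = tscale c (tlift2 f x y)"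
    by (simp_all add: tlift2_def tlift_add tlift_scale)
  show "tlift2 f x (y + y') = tlift2 f x y + tlift2 f x y'"
    by (simp add: tlift2_def tlift_add tlift_fun_add m multilinear_add)
  show "tlift2 f x (tscale c y) = tscale c (tlift2 f x y)"
    by (induction x rule: tens_induct)
       (simp_all add: tlift2_def tlift_add tlift_scale m multilinear_scale tv.scale_right_distrib mult.commute)
qed

instantiation tens :: ring
begin

definition times_tens :: "tens \<Rightarrow> tens \<Rightarrow> tens" where
  "times_tens = tlift2 pure_mult"

lemma tens_mult:
  "pure xs * pure ys = pure_mult xs ys"
  "(x + x') * y = x * y + x' * (y :: tens)"
  "x * (y + y') = x * y + x * (y' :: tens)"
  "tscale c x * y = tscale c (x * y)"
  "x * tscale c y = tscale c (x * y)"
  unfolding times_tens_def by (rule tlift2; rule multilinear_pure_mult)+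

instance
proof
  fix x y z :: tens
  have zero: "0 * a = 0" "a * 0 = 0" for a :: tens
    using tens_mult(4)[of 0 0 a] tens_mult(5)[of a 0 0] by simp_all
  show "x * y * z = x * (y * z)"
  proof (induction x rule: tens_induct)
    case (pure xs)
    show ?case
    proof (induction y rule: tens_induct)
      case (pure ys)
      show ?case
      proof (induction z rule: tens_induct)
        case (pure zs)
        have "length xs = length ys \<Longrightarrow> length ys = length zs \<Longrightarrow>
          map2 (*) (map2 (*) xs ys) zs = map2 (*) xs (map2 (*) ys zs)"
          by (induction xs ys zs rule: list_induct3) (simp_all add: mult.assoc)
        then show ?case
          by (auto simp: tens_mult(1) pure_mult_def zero)
      qed (simp_all add: tens_mult)
    qed (simp_all add: tens_mult)
  qed (simp_all add: tens_mult)
qed (rule tens_mult)+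

end

definition tcat :: "tens \<Rightarrow> tens \<Rightarrow> tens" (infixr \<open>\<otimes>\<^sub>t\<close> 75) where
  "x \<otimes>\<^sub>t y = tlift2 (\<lambda>xs ys. pure (xs @ ys)) x y"

lemma multilinear_append:
  "multilinear (\<lambda>ys. pure (xs @ ys))" "multilinear (\<lambda>xs. pure (xs @ ys))"
  unfolding multilinear_def
  using pure_add[of "xs @ _"] pure_scale[of "xs @ _"] pure_add pure_scale by simp_all

lemmas tcat = tlift2[of "\<lambda>xs ys. pure (xs @ ys)", OF multilinear_append(2) multilinear_append(1), folded tcat_def]

definition tunit :: "nat \<Rightarrow> tens" where
  "tunit n = pure (replicate n 1)"

lemma tunit_mult: 
  assumes "x \<in> tpow n" shows "tunit n * x = x" "x * tunit n = x"
proof -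
  have "map2 (*) (replicate (length xs) 1) xs = (xs :: U list)"
    "map2 (*) xs (replicate (length xs) 1) = (xs :: U list)" for xs
    by (induction xs) simp_all
  note units = this
  have "tunit n * x = x \<and> x * tunit n = x" using assms unfolding tpow_def
    by (induction x rule: tv.span_induct_alt)
       (auto simp: units tunit_def tens_mult pure_mult_def)
  then show "tunit n * x = x" "x * tunit n = x" by auto
qed

lemma tpow_mult:
  assumes "x \<in> tpow n" "y \<in> tpow n"
  shows "x * y \<in> tpow n"
  using assms(1) unfolding tpow_def
proof (induction x rule: tv.span_induct_alt)
  case (step c x z)
  then obtain xs where xs: "x = pure xs" "length xs = n" by blast
  from assms(2) have "x * y \<in> tpow n" unfolding tpow_def
  proof (induction y rule: tv.span_induct_alt)
    case (step d y w)
    then obtain ys where "y = pure ys" "length ys = n" by blast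
    then have "x * y \<in> tpow n" by (simp add: xs tens_mult pure_mult_def pure_in_tpow)
    with step show ?case
      by (simp add: tens_mult tpow_def tv.span_add tv.span_scale)
  qed (simp add: tv.span_zero)
  with step show ?case by (simp add: tens_mult tpow_def tv.span_add tv.span_scale)
qed (simp add: tv.span_zero)


section \<open>Coproduct\<close>

primrec coprod_gen :: "gen \<Rightarrow> tens" where
  "coprod_gen gFp = pure [uFp, uP] + pure [1, uFp]"
| "coprod_gen gFm = pure [uFm, uP] + pure [1, uFm]"
| "coprod_gen gH = pure [uH, 1] + pure [1, uH]"
| "coprod_gen gEp = pure [uEp, 1] + pure [1, uEp]"
| "coprod_gen gEm = pure [uEm, 1] + pure [1, uEm]"
| "coprod_gen gP = pure [uP, uP]"

definition coprod_word :: "gen list \<Rightarrow> tens" where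
  "coprod_word w = foldr (\<lambda>g t. coprod_gen g * t) w (tunit 2)"

lemma coprod_gen_tpow: "coprod_gen g \<in> tpow 2"
proof -
  have "pure [a, b] \<in> tpow 2" for a b by (simp add: pure_in_tpow)
  then show ?thesis by (cases g) (auto simp: tpow_def intro: tv.span_add)
qed

lemma coprod_word_tpow: "coprod_word w \<in> tpow 2"
  by (induction w) (simp_all add: coprod_word_def tunit_def pure_in_tpow tpow_mult coprod_gen_tpow)

lemma coprod_word_append: "coprod_word (v @ w) = coprod_word v * coprod_word w"
  by (induction v) (simp_all add: coprod_word_def mult.assoc tunit_mult(1)
      coprod_word_tpow[unfolded coprod_word_def])

lemma coprod_free_mult:
  "linext tscale coprod_word (p * q) = linext tscale coprod_word p * linext tscale coprod_word q"
proof (induction p rule: free_induct)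
  case (single k c)
  show ?case
    by (induction q rule: free_induct)
       (simp_all add: tlinext mult_single plus_list_def coprod_word_append tens_mult distrib_left mult.commute)
qed (simp add: tlinext distrib_right)

lemma coprod_free_gen: "linext tscale coprod_word (fgen g) = coprod_gen g"
  by (simp add: fgen_def tlinext coprod_word_def tunit_mult coprod_gen_tpow)

lemma coprod_free_one: "linext tscale coprod_word 1 = tunit 2"
proof -
  have "coprod_word 0 = tunit 2" by (simp add: coprod_word_def zero_list_def)
  then show ?thesis using tlinext(6)[of coprod_word 0 1] by simp
qed

lemma U_normal_order:
  "uH * uEp = uEp * uH + uEp"
  "uH * uEm = uEm * uH - uEm"
  "uEp * uEm = uEm * uEp + uscale 2 uH"
  "uH * uFp = uFp * uH + uscale (1/2) uFp"
  "uH * uFm = uFm * uH - uscale (1/2) uFm"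
  "uFp * uFm = uscale (1/2) uH - uFm * uFp"
  "uEp * uFm = uFm * uEp - uFp"
  "uEm * uFp = uFp * uEm - uFm"
  "uP * uEp = uEp * uP"
  "uP * uEm = uEm * uP"
  "uP * uH = uH * uP"
  "uP * uFp = - (uFp * uP)"
  "uP * uFm = - (uFm * uP)"
  "uFp * uFp = uscale (1/4) uEp"
  "uFm * uFm = - uscale (1/4) uEm"
  "uP * uP = 1"
proof -
  have half: "a = uscale (1/4) b" if "a + a = uscale (1/2) b" for a b :: U
  proof -
    have "uscale (1/2) (a + a) = a"
      by (simp only: uv.scale_right_distrib uv.scale_left_distrib[symmetric]) simp
    then show ?thesis using that by simp
  qed
  show "uFp * uFp = uscale (1/4) uEp"
    using U_relations(9) by (intro half) (simp add: anticommutator_def)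
  have "- (uFm * uFm) + - (uFm * uFm) = - anticommutator uFm uFm"
    by (simp add: anticommutator_def)
  then have "- (uFm * uFm) = uscale (1/4) uEm"
    by (intro half) (simp only: U_relations(10) minus_minus)
  then show "uFm * uFm = - uscale (1/4) uEm" by (metis minus_minus)
qed (use U_relations in \<open>simp_all add: commutator_def anticommutator_def algebra_simps eq_neg_iff_add_eq_0\<close>)

lemma pure2:
  "pure [a + a', b] = pure [a, b] + pure [a', b]"
  "pure [a, b + b'] = pure [a, b] + pure [a, b']"
  "pure [uscale c a, b] = tscale c (pure [a, b])"
  "pure [a, uscale c b] = tscale c (pure [a, b])"
  using pure_add[of "[]" _ _ "[b]"] pure_add[of "[a]" _ _ "[]"]
    pure_scale[of "[]" _ _ "[b]"] pure_scale[of "[a]" _ _ "[]"] by simp_all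

lemma pure2_minus:
  "pure [- a, b] = - pure [a, b]" "pure [a, - b] = - pure [a, b]"
  "pure [a - a', b] = pure [a, b] - pure [a', b]"
  "pure [a, b - b'] = pure [a, b] - pure [a, b']"
proof -
  show n: "pure [- a, b] = - pure [a, b]" "pure [a, - b] = - pure [a, b]" for a b
    using pure2(3)[of "-1" a b] pure2(4)[of a "-1" b] by simp_all
  show "pure [a - a', b] = pure [a, b] - pure [a', b]"
    "pure [a, b - b'] = pure [a, b] - pure [a, b']"
    using pure2(1)[of a "- a'" b] pure2(2)[of a b "- b'"] by (simp_all add: n)
qed

lemma coprod_relators: "r \<in> osp_relators \<Longrightarrow> linext tscale coprod_word r = 0"
proof -
  have half: "tscale (1/2) x = tscale (1/4) x + tscale (1/4) x" for x
    by (simp flip: tv.scale_left_distrib)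
  assume "r \<in> osp_relators"
  then show "linext tscale coprod_word r = 0"
    unfolding osp_relators_def insert_iff empty_iff
    by (elim disjE FalseE; simp only: commutator_def anticommutator_def tlinext coprod_free_mult
        coprod_free_gen coprod_free_one)
       (simp_all add: tens_mult(1) pure_mult_def distrib_left distrib_right
        pure2 pure2_minus U_normal_order tv.scale_right_distrib tunit_def numeral_2_eq_2 half)
qed

lifting_forget tens.lifting

lift_definition coprod :: "U \<Rightarrow> tens" is "linext tscale coprod_word"
proof -
  fix p q assume "osp_rel p q"
  have "linext tscale coprod_word x = 0" if "x \<in> osp_ideal" for x
    using that unfolding osp_ideal_def
    by (induction x rule: fv.span_induct_alt)
       (auto simp: tlinext coprod_free_mult coprod_relators)
  with \<open>osp_rel p q\<close> have "linext tscale coprod_word (p - q) = 0"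
    by (simp add: osp_rel_def)
  then show "linext tscale coprod_word p = linext tscale coprod_word q"
    by (simp add: tlinext)
qed

lemma coprod_hom:
  "coprod (a + b) = coprod a + coprod b"
  "coprod (uscale c a) = tscale c (coprod a)"
  "coprod (a * b) = coprod a * coprod b"
  "coprod 1 = tunit 2"
  "coprod (ugen g) = coprod_gen g"
  by (transfer; simp add: tlinext coprod_free_mult coprod_free_one coprod_free_gen)+

definition ulinear :: "(U \<Rightarrow> tens) \<Rightarrow> bool" where
  "ulinear f \<longleftrightarrow> (\<forall>a b. f (a + b) = f a + f b) \<and> (\<forall>c a. f (uscale c a) = tscale c (f a))"

text \<open>\<open>id_tensor f\<close> is \<open>id \<otimes> f\<close> on \<open>U \<otimes> U\<close>.\<close>

definition id_tensor :: "(U \<Rightarrow> tens) \<Rightarrow> tens \<Rightarrow> tens" where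
  "id_tensor f = tlift (\<lambda>xs. case xs of [a, b] \<Rightarrow> pure [a] \<otimes>\<^sub>t f b | _ \<Rightarrow> 0)"

lemma multilinear_id_tensor:
  assumes "ulinear f"
  shows "multilinear (\<lambda>xs. case xs of [a, b] \<Rightarrow> pure [a] \<otimes>\<^sub>t f b | _ \<Rightarrow> 0)"
proof -
  have p: "pure [a + b] = pure [a] + pure [b]" "pure [uscale c a] = tscale c (pure [a])" for a b c
    using pure_add[of "[]" a b "[]"] pure_scale[of "[]" c a "[]"] by simp_all
  have f: "f (a + b) = f a + f b" "f (uscale c a) = tscale c (f a)" for a b c
    using assms by (auto simp: ulinear_def)
  have "(case xs @ a # ys of [a, b] \<Rightarrow> pure [a] \<otimes>\<^sub>t f b | _ \<Rightarrow> 0) =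
      (if xs = [] \<and> length ys = 1 then pure [a] \<otimes>\<^sub>t f (hd ys)
       else if length xs = 1 \<and> ys = [] then pure [hd xs] \<otimes>\<^sub>t f a else 0)" for xs a ys
    by (auto split: list.split simp: length_Suc_conv append_eq_Cons_conv)
  then show ?thesis
    unfolding multilinear_def by (auto simp: p f tcat)
qed

lemma id_tensor_pure: "ulinear f \<Longrightarrow> id_tensor f (pure [a, b]) = pure [a] \<otimes>\<^sub>t f b"
  by (simp add: id_tensor_def multilinear_id_tensor)

primrec iter_coprod :: "nat \<Rightarrow> U \<Rightarrow> tens" where
  "iter_coprod 0 u = pure [u]"
| "iter_coprod (Suc k) u = id_tensor (iter_coprod k) (coprod u)"

lemma ulinear_iter_coprod: "ulinear (iter_coprod k)"
proof (induction k)
  case 0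
  show ?case
    using pure_add[of "[]" _ _ "[]"] pure_scale[of "[]" _ _ "[]"] by (simp add: ulinear_def)
next
  case (Suc k)
  show ?case
    by (simp add: ulinear_def coprod_hom id_tensor_def tlift_add tlift_scale)
qed


section \<open>The action of the symmetric group by the R-matrix\<close>

definition Rmat :: tens where
  "Rmat = tscale (1/2) (pure [1, 1] + pure [uP, 1] + pure [1, uP] - pure [uP, uP])"

definition Rmat_adj :: "nat \<Rightarrow> nat \<Rightarrow> tens" where
  "Rmat_adj n i = tunit (i - 1) \<otimes>\<^sub>t Rmat \<otimes>\<^sub>t tunit (n - i - 1)"

text \<open>Factors are numbered from 1, list positions from 0.\<close>

definition swap_list :: "nat \<Rightarrow> 'a list \<Rightarrow> 'a list" where
  "swap_list i xs = (if 1 \<le> i \<and> i < length xs then xs[i - 1 := xs ! i, i := xs ! (i - 1)] else xs)"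

definition swap_factors :: "nat \<Rightarrow> tens \<Rightarrow> tens" where
  "swap_factors i = tlift (\<lambda>xs. pure (swap_list i xs))"

lemma length_swap_list [simp]: "length (swap_list i xs) = length xs"
  by (simp add: swap_list_def)

lemma multilinear_swap: "multilinear (\<lambda>xs. pure (swap_list i xs))"
proof -
  have upd: "pure (zs[k := a + b]) = pure (zs[k := a]) + pure (zs[k := b])"
    "pure (zs[k := uscale c a]) = tscale c (pure (zs[k := a]))" if "k < length zs" for zs k a b c
    using that by (simp_all add: upd_conv_take_nth_drop pure_add pure_scale)
  have "\<exists>zs k. k < length zs \<and> (\<forall>a. swap_list i (xs @ a # ys) = zs[k := a])" for xs ys :: "U list"
  proof -
    define zs where "zs = xs @ 0 # ys"
    define \<tau> where "\<tau> = (if 1 \<le> i \<and> i < length zs then transpose (i - 1) i else id)"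
    have \<tau>\<tau>: "\<tau> (\<tau> j) = j" for j by (simp add: \<tau>_def)
    have lt: "\<tau> j < length zs" if "j < length zs" for j
      using that by (auto simp: \<tau>_def transpose_def)
    have nth: "swap_list i us ! j = us ! \<tau> j" if "j < length zs" "length us = length zs" for us :: "U list" and j
      using that by (auto simp: swap_list_def \<tau>_def nth_list_update transpose_def)
    have "swap_list i (xs @ a # ys) = (swap_list i zs)[\<tau> (length xs) := a]" for a
    proof (rule nth_equalityI)
      show "length (swap_list i (xs @ a # ys)) = length ((swap_list i zs)[\<tau> (length xs) := a])"
        by (simp add: zs_def)
      fix j assume "j < length (swap_list i (xs @ a # ys))"
      then have j: "j < length zs" by (simp add: zs_def)
      have *: "xs @ a # ys = zs[length xs := a]" by (simp add: zs_def)
      have "length xs < length zs" by (simp add: zs_def)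
      then show "swap_list i (xs @ a # ys) ! j = (swap_list i zs)[\<tau> (length xs) := a] ! j"
        using j lt \<tau>\<tau> by (auto simp: * nth nth_list_update)
    qed
    moreover have "\<tau> (length xs) < length (swap_list i zs)" using lt by (simp add: zs_def)
    ultimately show ?thesis by blast
  qed
  note hole = this
  show ?thesis
    unfolding multilinear_def
  proof (intro conjI allI)
    fix xs ys :: "U list" and a b c
    obtain zs k where k: "k < length zs" "\<And>a. swap_list i (xs @ a # ys) = zs[k := a]"
      using hole by blast
    show "pure (swap_list i (xs @ (a + b) # ys)) =
        pure (swap_list i (xs @ a # ys)) + pure (swap_list i (xs @ b # ys))"
      "pure (swap_list i (xs @ uscale c a # ys)) = tscale c (pure (swap_list i (xs @ a # ys)))"
      unfolding k(2) by (rule upd[OF k(1)])+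
  qed
qed

text \<open>The operator \<open>Rcheck\<close> on the \<open>n\<close>-th tensor power. Conjugation by it sends (left multiplication
  by) \<open>X\<close> to (left multiplication by) \<open>gamma_gen n i X\<close>, using that \<open>Rmat\<close> is its own inverse;
  cf. \<open>Rcheck_conj\<close>.\<close>

definition Rcheck :: "nat \<Rightarrow> nat \<Rightarrow> tens \<Rightarrow> tens" where
  "Rcheck n i Y = Rmat_adj n i * swap_factors i Y"

definition gamma_gen :: "nat \<Rightarrow> nat \<Rightarrow> tens \<Rightarrow> tens" where
  "gamma_gen n i X = Rmat_adj n i * swap_factors i X * Rmat_adj n i"

lemma swap_factors_mult: "swap_factors i (X * Y) = swap_factors i X * swap_factors i Y"
proof -
  have sw: "swap_factors i (pure xs) = pure (swap_list i xs)" for xs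
    by (simp add: swap_factors_def multilinear_swap)
  have lin: "swap_factors i (x + y) = swap_factors i x + swap_factors i y"
    "swap_factors i (tscale c x) = tscale c (swap_factors i x)" "swap_factors i 0 = 0" for x y c
    by (simp_all add: swap_factors_def tlift_add tlift_scale)
  have "swap_list i (map2 (*) xs ys) = map2 (*) (swap_list i xs) (swap_list i ys)"
    if "length xs = length ys" for xs ys :: "U list"
    using that by (intro nth_equalityI) (auto simp: swap_list_def nth_list_update)
  then have sw_mult: "swap_factors i (pure xs * pure ys) = swap_factors i (pure xs) * swap_factors i (pure ys)" for xs ys
    by (simp add: tens_mult(1) pure_mult_def sw lin)
  show ?thesis
  proof (induction X rule: tens_induct)
    case (pure xs)
    show ?case by (induction Y rule: tens_induct) (simp_all add: sw_mult lin tens_mult(2-5))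
  qed (simp_all add: lin tens_mult(2-5))
qed

lemma tcat_mult:
  assumes "x \<in> tpow m" "x' \<in> tpow m"
  shows "(x \<otimes>\<^sub>t y) * (x' \<otimes>\<^sub>t y') = (x * x') \<otimes>\<^sub>t (y * y')"
proof -
  have z: "0 \<otimes>\<^sub>t a = 0" "a \<otimes>\<^sub>t 0 = 0" for a
    using tcat(4)[of 0 0 a] tcat(5)[of a 0 0] by simp_all
  have pure: "(pure xs \<otimes>\<^sub>t y) * (pure xs' \<otimes>\<^sub>t y') = (pure xs * pure xs') \<otimes>\<^sub>t (y * y')"
    if "length xs = length xs'" for xs xs'
  proof (induction y rule: tens_induct)
    case (pure ys)
    show ?case
      by (induction y' rule: tens_induct)
         (use that in \<open>simp_all add: tcat tens_mult pure_mult_def z\<close>)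
  qed (simp_all add: tcat tens_mult)
  show ?thesis using assms(1) unfolding tpow_def
  proof (induction x rule: tv.span_induct_alt)
    case (step c x w)
    then obtain xs where xs: "x = pure xs" "length xs = m" by blast
    have "(x \<otimes>\<^sub>t y) * (x' \<otimes>\<^sub>t y') = (x * x') \<otimes>\<^sub>t (y * y')"
      using assms(2) unfolding tpow_def
      by (induction x' rule: tv.span_induct_alt) (auto simp: xs pure tcat tens_mult z)
    with step show ?case by (simp add: tcat tens_mult)
  qed (simp add: z)
qed

lemma tcat_tpow:
  assumes "x \<in> tpow m" "y \<in> tpow n"
  shows "x \<otimes>\<^sub>t y \<in> tpow (m + n)"
proof -
  have z: "0 \<otimes>\<^sub>t a = 0" "a \<otimes>\<^sub>t 0 = 0" for a
    using tcat(4)[of 0 0 a] tcat(5)[of a 0 0] by simp_all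
  show ?thesis using assms(1) unfolding tpow_def[of m]
  proof (induction x rule: tv.span_induct_alt)
    case base
    then show ?case by (simp add: z tpow_def tv.span_zero)
  next
    case (step c x w)
    then obtain xs where xs: "x = pure xs" "length xs = m" by blast
    have "x \<otimes>\<^sub>t y \<in> tpow (m + n)"
      using assms(2) unfolding tpow_def[of n]
    proof (induction y rule: tv.span_induct_alt)
      case base
      then show ?case by (simp add: z tpow_def tv.span_zero)
    next
      case (step d y v)
      then obtain ys where "y = pure ys" "length ys = n" by blast
      then have "x \<otimes>\<^sub>t y \<in> tpow (m + n)" by (simp add: xs tcat pure_in_tpow)
      with step show ?case by (simp add: tcat tpow_def tv.span_add tv.span_scale)
    qed
    with step show ?case by (simp add: tcat tpow_def tv.span_add tv.span_scale)
  qed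
qed

lemma tunit_tpow: "tunit n \<in> tpow n"
  by (simp add: tunit_def pure_in_tpow)

lemma Rmat_tpow: "Rmat \<in> tpow 2"
proof -
  have "pure [a, b] \<in> tpow 2" for a b by (simp add: pure_in_tpow)
  then show ?thesis by (simp add: Rmat_def tpow_def tv.span_add tv.span_diff tv.span_scale)
qed

lemma Rmat_square: "Rmat * Rmat = tunit 2"
proof -
  have "Rmat * Rmat = tscale (1/4) (tscale 4 (pure [1, 1]))"
    unfolding Rmat_def
    by (simp add: tens_mult pure_mult_def U_normal_order algebra_simps)
       (simp flip: tv.scale_left_distrib add: tv.scale_right_distrib)
  then show ?thesis by (simp add: tunit_def numeral_2_eq_2)
qed

lemma tunit_cat: "tunit m \<otimes>\<^sub>t tunit n = tunit (m + n)"
  by (simp add: tunit_def tcat replicate_add)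

lemma Rmat_adj_square:
  assumes "1 \<le> i" "i < n"
  shows "Rmat_adj n i * Rmat_adj n i = tunit n"
proof -
  have n: "i - 1 + (2 + (n - i - 1)) = n" using assms by simp
  show ?thesis
    by (simp only: Rmat_adj_def tcat_mult[OF tunit_tpow tunit_tpow] tcat_mult[OF Rmat_tpow Rmat_tpow]
        tunit_mult(1)[OF tunit_tpow] Rmat_square tunit_cat n)
qed

lemma swap_factors_tpow: "X \<in> tpow n \<Longrightarrow> swap_factors i X \<in> tpow n"
  unfolding tpow_def[of n]
proof (induction X rule: tv.span_induct_alt)
  case base
  show ?case by (simp add: swap_factors_def tpow_def tv.span_zero)
next
  case (step c x w)
  then have "swap_factors i x \<in> tpow n"
    by (auto simp: swap_factors_def multilinear_swap intro!: pure_in_tpow)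
  with step show ?case
    by (simp add: swap_factors_def tlift_add tlift_scale tpow_def tv.span_add tv.span_scale)
qed

lemma Rcheck_conj:
  assumes "1 \<le> i" "i < n" "Y \<in> tpow n"
  shows "Rcheck n i (X * Y) = gamma_gen n i X * Rcheck n i Y"
proof -
  have "gamma_gen n i X * Rcheck n i Y =
      Rmat_adj n i * swap_factors i X * ((Rmat_adj n i * Rmat_adj n i) * swap_factors i Y)"
    by (simp add: gamma_gen_def Rcheck_def mult.assoc)
  also have "\<dots> = Rmat_adj n i * swap_factors i X * swap_factors i Y"
    using assms by (simp add: Rmat_adj_square tunit_mult swap_factors_tpow)
  finally show ?thesis by (simp add: Rcheck_def swap_factors_mult mult.assoc)
qed

definition word_perm :: "nat list \<Rightarrow> nat \<Rightarrow> nat" where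
  "word_perm w = foldr (\<lambda>i f. transpose i (i + 1) \<circ> f) w id"

definition gamma_word :: "nat \<Rightarrow> nat list \<Rightarrow> tens \<Rightarrow> tens" where
  "gamma_word n w X = foldr (gamma_gen n) w X"

text \<open>The two choices below are immaterial: the results are independent of the decomposition of \<open>s\<close>
  and of the interval and the permutation.\<close>

definition gamma :: "nat \<Rightarrow> (nat \<Rightarrow> nat) \<Rightarrow> tens \<Rightarrow> tens" where
  "gamma n s X = gamma_word n (SOME w. set w \<subseteq> {1..<n} \<and> word_perm w = s) X"

definition interval_casimir :: "nat \<Rightarrow> nat \<Rightarrow> nat \<Rightarrow> tens" where
  "interval_casimir n k l = tunit (k - 1) \<otimes>\<^sub>t iter_coprod (l - k) casimir \<otimes>\<^sub>t tunit (n - l)"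

definition intermediate_casimir :: "nat \<Rightarrow> nat set \<Rightarrow> tens" where
  "intermediate_casimir n A =
    (if A = {} then tunit n
     else SOME X. \<exists>k l s. 1 \<le> k \<and> k \<le> l \<and> l \<le> n \<and> card {k..l} = card A \<and>
       s permutes {1..n} \<and> s ` {k..l} = A \<and> X = gamma n s (interval_casimir n k l))"

definition diag_centralizer :: "nat \<Rightarrow> tens set" where
  "diag_centralizer n =
    {X \<in> tpow n. \<forall>x\<in>osp12. commutator (iter_coprod (n - 1) x) X = 0}"

end

theory Submission
  imports Defs
begin

text \<open>Since \<open>H\<close> and \<open>E\<^sup>\<plusminus>\<close> are polynomials in \<open>F\<^sup>\<plusminus>\<close>, it suffices to commute with the diagonal \<open>F\<^sup>\<plusminus>\<close>.
  On a product of three blocks, the diagonal \<open>F\<^sup>\<plusminus>\<close> is a sum of three terms, in each of which the middle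
  block carries \<open>F\<^sup>\<plusminus>\<close>, a string of \<open>P\<close>'s or the unit. For \<open>C\<^sub>K\<close> with \<open>K\<close> an interval, the middle factor
  commutes with all of these because \<open>C\<close> is central. For general \<open>A\<close>, conjugation by the braiding
  of factors \<open>i\<close> and \<open>i + 1\<close> fixes the diagonal \<open>F\<^sup>\<plusminus>\<close>, by \<open>R \<Delta>\<^sup>o\<^sup>p R = \<Delta>\<close> applied to the
  middle block, so it preserves the centralizer.\<close>

section \<open>Juxtaposition of tensors\<close>

lemma tpow_add: "x \<in> tpow n \<Longrightarrow> y \<in> tpow n \<Longrightarrow> x + y \<in> tpow n"
  and tpow_scale: "x \<in> tpow n \<Longrightarrow> tscale c x \<in> tpow n"
  and tpow_zero: "0 \<in> tpow n"
  unfolding tpow_def by (rule tv.span_add tv.span_scale tv.span_zero; assumption)+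

lemma tpow_induct [consumes 1, case_names pure add scale zero]:
  assumes "x \<in> tpow n"
    and "\<And>xs. length xs = n \<Longrightarrow> Q (pure xs)"
    and "\<And>x y. x \<in> tpow n \<Longrightarrow> y \<in> tpow n \<Longrightarrow> Q x \<Longrightarrow> Q y \<Longrightarrow> Q (x + y)"
    and "\<And>c x. x \<in> tpow n \<Longrightarrow> Q x \<Longrightarrow> Q (tscale c x)"
    and "Q 0"
  shows "Q x"
proof -
  have "x \<in> tpow n \<and> Q x"
    using assms(1) unfolding tpow_def[of n]
  proof (induction x rule: tv.span_induct_alt)
    case base
    show ?case using assms(5) tpow_zero[of n] by (simp add: tpow_def)
  next
    case (step c x y)
    then obtain xs where "x = pure xs" "length xs = n" by blast
    then have "x \<in> tpow n" "Q x" by (simp_all add: pure_in_tpow assms(2))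
    with step show ?case
      by (simp add: assms(3,4) tpow_add tpow_scale flip: tpow_def)
  qed
  then show ?thesis ..
qed

lemma tcat_zero [simp]: "0 \<otimes>\<^sub>t x = 0" "x \<otimes>\<^sub>t 0 = 0"
  using tcat(4)[of 0 0 x] tcat(5)[of x 0 0] by simp_all

lemma tcat_assoc: "(x \<otimes>\<^sub>t y) \<otimes>\<^sub>t z = x \<otimes>\<^sub>t y \<otimes>\<^sub>t z"
proof (induction x rule: tens_induct)
  case (pure xs)
  show ?case
  proof (induction y rule: tens_induct)
    case (pure ys)
    show ?case by (induction z rule: tens_induct) (simp_all add: tcat)
  qed (simp_all add: tcat)
qed (simp_all add: tcat)

lemma tunit_0_tcat [simp]: "tunit 0 \<otimes>\<^sub>t x = x"
  by (induction x rule: tens_induct) (simp_all add: tcat tunit_def)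

lemma tcat_tpow': "x \<in> tpow m \<Longrightarrow> y \<in> tpow k \<Longrightarrow> m + k = n \<Longrightarrow> x \<otimes>\<^sub>t y \<in> tpow n"
  using tcat_tpow by blast


section \<open>Multiplicativity of the iterated coproduct\<close>

lemma coprod_tpow: "coprod u \<in> tpow 2"
proof (induction u rule: U.abs_induct)
  case (1 p)
  have "linext tscale coprod_word p \<in> tpow 2"
    by (induction p rule: free_induct) (simp_all add: tlinext tpow_add tpow_scale coprod_word_tpow)
  then show ?case by (simp add: coprod.abs_eq)
qed

lemma id_tensor_add: "id_tensor f (x + y) = id_tensor f x + id_tensor f y"
  and id_tensor_scale: "id_tensor f (tscale c x) = tscale c (id_tensor f x)"
  by (simp_all add: id_tensor_def tlift_add tlift_scale)

lemma id_tensor_zero: "id_tensor f 0 = 0"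
  by (simp add: id_tensor_def)

lemma id_tensor_tpow:
  assumes "ulinear f" "\<And>u. f u \<in> tpow m" "x \<in> tpow 2"
  shows "id_tensor f x \<in> tpow (Suc m)"
  using assms(3)
proof (induction x rule: tpow_induct)
  case (pure xs)
  then obtain a b where "xs = [a, b]" by (auto simp: length_Suc_conv numeral_2_eq_2)
  then show ?case
    using tcat_tpow[OF pure_in_tpow[of "[a]" 1] assms(2)[of b]] by (simp add: id_tensor_pure assms)
qed (simp_all add: id_tensor_add id_tensor_scale id_tensor_zero tpow_add tpow_scale tpow_zero)

lemma id_tensor_mult:
  assumes f: "ulinear f" "\<And>u v. f (u * v) = f u * f v" and "x \<in> tpow 2" "y \<in> tpow 2"
  shows "id_tensor f (x * y) = id_tensor f x * id_tensor f y"
  using assms(3)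
proof (induction x rule: tpow_induct)
  case (pure xs)
  then obtain a b where xs: "xs = [a, b]" by (auto simp: length_Suc_conv numeral_2_eq_2)
  show ?case using assms(4)
  proof (induction y rule: tpow_induct)
    case (pure ys)
    then obtain c d where "ys = [c, d]" by (auto simp: length_Suc_conv numeral_2_eq_2)
    then show ?case
      by (simp add: xs tens_mult(1) pure_mult_def id_tensor_pure f
          tcat_mult[of _ 1] pure_in_tpow)
  qed (simp_all add: tens_mult id_tensor_add id_tensor_scale id_tensor_zero)
qed (simp_all add: tens_mult id_tensor_add id_tensor_scale id_tensor_zero)

lemma iter_coprod_tpow: "iter_coprod k u \<in> tpow (Suc k)"
proof (induction k arbitrary: u)
  case 0
  show ?case by (simp add: pure_in_tpow)
qed (simp add: id_tensor_tpow ulinear_iter_coprod coprod_tpow)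

lemma iter_coprod_add: "iter_coprod k (u + v) = iter_coprod k u + iter_coprod k v"
  and iter_coprod_scale: "iter_coprod k (uscale c u) = tscale c (iter_coprod k u)"
  using ulinear_iter_coprod[of k] by (auto simp: ulinear_def)

lemma iter_coprod_mult: "iter_coprod k (u * v) = iter_coprod k u * iter_coprod k v"
proof (induction k arbitrary: u v)
  case 0
  show ?case by (simp add: tens_mult(1) pure_mult_def)
qed (simp add: coprod_hom id_tensor_mult ulinear_iter_coprod coprod_tpow)

lemma iter_coprod_P: "iter_coprod k uP = pure (replicate (Suc k) uP)"
proof (induction k)
  case (Suc k)
  then show ?case by (simp add: coprod_hom id_tensor_pure ulinear_iter_coprod tcat)
qed simp

lemma iter_coprod_commute:
  "u * v = v * u \<Longrightarrow> iter_coprod k u * iter_coprod k v = iter_coprod k v * iter_coprod k u"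
  by (metis iter_coprod_mult)


section \<open>The odd generators on tensor powers\<close>

abbreviation Pstring :: "nat \<Rightarrow> tens" where
  "Pstring n \<equiv> pure (replicate n uP)"

text \<open>\<open>diag_odd f n\<close> is the sum over \<open>j\<close> of \<open>1 \<otimes> \<dots> \<otimes> 1 \<otimes> f \<otimes> P \<otimes> \<dots> \<otimes> P\<close> with \<open>f\<close> in position \<open>j\<close>. Unlike
  \<open>iter_coprod\<close>, it is indexed by the number of factors, so that \<open>n = 0\<close> is allowed.\<close>

primrec diag_odd :: "U \<Rightarrow> nat \<Rightarrow> tens" where
  "diag_odd f 0 = 0"
| "diag_odd f (Suc n) = pure [f] \<otimes>\<^sub>t Pstring n + tunit 1 \<otimes>\<^sub>t diag_odd f n"

lemma diag_odd_tpow: "diag_odd f n \<in> tpow n"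
proof (induction n)
  case 0
  show ?case by (simp add: tpow_zero)
next
  case (Suc n)
  then show ?case
    by (simp add: tpow_add tcat_tpow'[of _ 1 _ n] tunit_tpow pure_in_tpow del: One_nat_def)
qed

text \<open>If \<open>f\<close> sits among the first \<open>m\<close> positions, \<open>P\<close>
  fills all of the last \<open>n\<close>; otherwise the first \<open>m\<close> positions carry
  units.\<close>

lemma diag_odd_append:
  "diag_odd f (m + n) = diag_odd f m \<otimes>\<^sub>t Pstring n + tunit m \<otimes>\<^sub>t diag_odd f n"
proof (induction m)
  case (Suc m)
  have "tunit (Suc m) = tunit 1 \<otimes>\<^sub>t tunit m" by (simp add: tunit_cat)
  then show ?case
    by (simp add: Suc tcat(2,3) tcat_assoc) (simp add: tcat(1) replicate_add)
qed simp

text \<open>\<open>P\<close> is grouplike, so the summand \<open>f \<otimes> P\<close> expands to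
  \<open>f\<close> followed by a \<open>P\<close>-string. The \<open>k\<close>-th iterate has
  \<open>k + 1\<close> factors.\<close>

lemma iter_coprod_odd:
  assumes "coprod f = pure [f, uP] + pure [1, f]"
  shows "iter_coprod k f = diag_odd f (Suc k)"
proof (induction k)
  case 0
  show ?case by (simp add: tcat(1))
next
  case (Suc k)
  then show ?case
    by (simp add: assms id_tensor_add id_tensor_pure ulinear_iter_coprod iter_coprod_P)
      (simp add: tunit_def)
qed

section \<open>The Casimir element and its interval versions\<close>

lemma of_nat_mult_uscale: "of_nat m * u = uscale (of_nat m) u" for u :: U
  by (induction m) (simp_all add: distrib_right uv.scale_left_distrib)

lemma casimir_uscale: "casimir = uscale 8 (commutator uFp uFm * uP) + uP"
  using of_nat_mult_uscale[of 8 "commutator uFp uFm * uP"] by (simp add: casimir_def mult.assoc)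

text \<open>With \<open>K = [F^+, F^-]\<close>, the hypotheses give
  \<open>8KPf + Pf = -8KfP - fP = 8fKP + 2fP - fP\<close>; the coefficient 8 is what leaves exactly
  \<open>fP\<close> at the end.\<close>

lemma casimir_commute_odd:
  assumes P: "uP * f = - (f * uP)"
    and K: "commutator uFp uFm * f + f * commutator uFp uFm = - uscale (1/4) f"
  shows "casimir * f = f * casimir"
proof -
  define K where "K = commutator uFp uFm"
  have *: "K * f = - uscale (1/4) f - f * K"
    using K by (simp add: K_def eq_diff_eq)
  have "casimir * f = - uscale 8 (K * f * uP) - f * uP"
    by (simp add: casimir_uscale K_def[symmetric] distrib_right uscale_mult_left mult.assoc P)
  also have "\<dots> = uscale 2 (f * uP) - f * uP + uscale 8 (f * K * uP)"
    by (simp add: * left_diff_distrib uscale_mult_left uv.scale_right_diff_distrib)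
  also have "uscale 2 (f * uP) = f * uP + f * uP"
    using uv.scale_left_distrib[of 1 1 "f * uP"] by simp
  finally show ?thesis
    by (simp add: casimir_uscale K_def[symmetric] distrib_left uscale_mult_right mult.assoc)
qed

lemma casimir_commute:
  "casimir * uFp = uFp * casimir" "casimir * uFm = uFm * casimir" "casimir * uP = uP * casimir"
proof -
  \<comment> \<open>The two terms \<open>F^+ F^- F^+\<close> cancel, leaving the commutator of
    \<open>(F^+)^2 = E^+ / 4\<close> with \<open>F^-\<close>.\<close>
  have "commutator uFp uFm * uFp + uFp * commutator uFp uFm = commutator (uFp * uFp) uFm"
    by (simp add: commutator_def algebra_simps)
  also have "\<dots> = uscale (1/4) (commutator uEp uFm)"
    by (simp add: U_normal_order(14) commutator_def uscale_mult_left uscale_mult_right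
        uv.scale_right_diff_distrib)
  finally show "casimir * uFp = uFp * casimir"
    by (intro casimir_commute_odd) (simp_all add: U_relations U_normal_order)
  have "commutator uFp uFm * uFm + uFm * commutator uFp uFm = - commutator (uFm * uFm) uFp"
    by (simp add: commutator_def algebra_simps)
  also have "\<dots> = uscale (1/4) (commutator uEm uFp)"
    by (simp add: U_normal_order(15) commutator_def uscale_mult_left uscale_mult_right
        uv.scale_right_diff_distrib)
  finally show "casimir * uFm = uFm * casimir"
    by (intro casimir_commute_odd) (simp_all add: U_relations U_normal_order)
  have "uP * (uFp * uFm) = uFp * uFm * uP" "uP * (uFm * uFp) = uFm * uFp * uP"
    by (simp_all add: U_normal_order(12,13) mult.assoc flip: mult.assoc[of uP])
  then have "uP * commutator uFp uFm = commutator uFp uFm * uP"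
    by (simp add: commutator_def left_diff_distrib right_diff_distrib)
  then show "casimir * uP = uP * casimir"
    by (simp add: casimir_uscale distrib_left distrib_right uscale_mult_left uscale_mult_right
        flip: mult.assoc)
qed

lemma interval_casimir_tpow:
  assumes "1 \<le> k" "k \<le> l" "l \<le> n"
  shows "interval_casimir n k l \<in> tpow n"
  unfolding interval_casimir_def
  by (rule tcat_tpow'[OF tunit_tpow tcat_tpow'[OF iter_coprod_tpow tunit_tpow refl]])
    (use assms in simp)

lemma interval_casimir_diag_odd:
  assumes "1 \<le> k" "k \<le> l" "l \<le> n" and f: "coprod f = pure [f, uP] + pure [1, f]"
    and cf: "casimir * f = f * casimir"
  shows "diag_odd f n * interval_casimir n k l = interval_casimir n k l * diag_odd f n"
proof -
  \<comment> \<open>The iterated coproduct of \<open>C\<close> occupies \<open>l - k + 1\<close>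
    factors, hence the \<open>Suc\<close>; \<open>a\<close> and \<open>b\<close> count the units on
    either side.\<close>
  define a m b where "a = k - 1" and "m = Suc (l - k)" and "b = n - l"
  define X where "X = iter_coprod (l - k) casimir"
  have n: "n = a + (m + b)" using assms by (simp add: a_def b_def m_def)
  have tp: "X \<in> tpow m" "Pstring i \<in> tpow i" for i
    by (simp_all add: X_def m_def iter_coprod_tpow pure_in_tpow)
  \<comment> \<open>Besides the unit, these are the two middle blocks that occur in the diagonal
    \<open>f\<close>.\<close>
  have "X * Pstring m = Pstring m * X" "X * diag_odd f m = diag_odd f m * X"
    using iter_coprod_commute[OF casimir_commute(3), of "l - k"] iter_coprod_commute[OF cf, of "l - k"]
    by (simp_all only: X_def m_def iter_coprod_P iter_coprod_odd[OF f])
  then show ?thesis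
    unfolding interval_casimir_def a_def[symmetric] b_def[symmetric] X_def[symmetric]
    unfolding n diag_odd_append replicate_add
    \<comment> \<open>Concatenated \<open>P\<close>-strings are read back as juxtapositions, so that
      products become blockwise.\<close>
    unfolding tcat(1)[symmetric]
    by (simp add: distrib_left distrib_right tcat(2,3) tcat_mult[of _ a] tcat_mult[of _ m]
        tunit_tpow diag_odd_tpow tp tunit_mult)
qed


section \<open>The action of the adjacent transpositions\<close>

lemma Rmat_adj_tpow: "1 \<le> i \<Longrightarrow> i < n \<Longrightarrow> Rmat_adj n i \<in> tpow n"
  unfolding Rmat_adj_def
  by (rule tcat_tpow'[OF tunit_tpow tcat_tpow'[OF Rmat_tpow tunit_tpow refl]]) simp

lemma gamma_gen_tpow: "1 \<le> i \<Longrightarrow> i < n \<Longrightarrow> X \<in> tpow n \<Longrightarrow> gamma_gen n i X \<in> tpow n"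
  by (simp add: gamma_gen_def tpow_mult Rmat_adj_tpow swap_factors_tpow)

text \<open>Conjugation by the braiding is multiplicative; the cancelling pair of R-matrices is
  hidden in \<open>Rcheck_conj\<close>.\<close>

lemma gamma_gen_mult:
  assumes "1 \<le> i" "i < n" "Y \<in> tpow n"
  shows "gamma_gen n i (X * Y) = gamma_gen n i X * gamma_gen n i Y"
proof -
  have "gamma_gen n i (X * Y) = Rcheck n i (X * Y) * Rmat_adj n i"
    by (simp add: gamma_gen_def Rcheck_def)
  also have "\<dots> = gamma_gen n i X * (Rcheck n i Y * Rmat_adj n i)"
    by (simp only: Rcheck_conj[OF assms] mult.assoc)
  finally show ?thesis by (simp add: gamma_gen_def Rcheck_def)
qed

lemma swap_factors_lin:
  "swap_factors i (x + y) = swap_factors i x + swap_factors i y"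
  "swap_factors i (tscale c x) = tscale c (swap_factors i x)" "swap_factors i 0 = 0"
  "swap_factors i (pure xs) = pure (swap_list i xs)"
  by (simp_all add: swap_factors_def tlift_add tlift_scale multilinear_swap)

lemma gamma_gen_add: "gamma_gen n i (X + Y) = gamma_gen n i X + gamma_gen n i Y"
  by (simp add: gamma_gen_def swap_factors_lin distrib_left distrib_right)

text \<open>Factors are numbered from 1, so the block after \<open>a\<close> factors starts at
  \<open>Suc a\<close>.\<close>

lemma swap_factors_tcat:
  assumes "x \<in> tpow a" "y \<in> tpow 2"
  shows "swap_factors (Suc a) (x \<otimes>\<^sub>t y \<otimes>\<^sub>t z) = x \<otimes>\<^sub>t swap_factors 1 y \<otimes>\<^sub>t z"
  using assms(1)
proof (induction x rule: tpow_induct)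
  case (pure xs)
  show ?case using assms(2)
  proof (induction y rule: tpow_induct)
    case (pure ys)
    then obtain u v where "ys = [u, v]" by (auto simp: length_Suc_conv numeral_2_eq_2)
    then show ?case using \<open>length xs = a\<close>
      by (induction z rule: tens_induct)
        (simp_all add: tcat swap_factors_lin swap_list_def nth_append list_update_append)
  qed (simp_all add: tcat(2-5) swap_factors_lin)
qed (simp_all add: tcat(2-5) swap_factors_lin)

lemma gamma_gen_tcat:
  assumes "x \<in> tpow a" "y \<in> tpow 2" "z \<in> tpow b" "n = a + (2 + b)"
  shows "gamma_gen n (Suc a) (x \<otimes>\<^sub>t y \<otimes>\<^sub>t z) = x \<otimes>\<^sub>t (Rmat * swap_factors 1 y * Rmat) \<otimes>\<^sub>t z"
proof -
  have "n - Suc a - 1 = b" using assms(4) by simp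
  then show ?thesis
    using assms(1-3)
    by (simp add: gamma_gen_def Rmat_adj_def swap_factors_tcat tcat_mult[of _ a] tcat_mult[of _ 2]
        tunit_tpow tunit_mult Rmat_tpow swap_factors_tpow tpow_mult del: One_nat_def)
qed

text \<open>The identity \<open>R \<Delta>\<^sup>o\<^sup>p(f) R = \<Delta>(f)\<close> for odd \<open>f\<close>.\<close>

lemma Rmat_conj_odd:
  assumes "uP * f = - (f * uP)"
  shows "Rmat * swap_factors 1 (diag_odd f 2) * Rmat = diag_odd f 2"
proof -
  have PP: "uP * uP = 1" "uP * (uP * u) = u" for u
    by (simp_all add: U_normal_order flip: mult.assoc)
  have Pf: "uP * (f * u) = - (f * (uP * u))" for u
    using assms by (metis mult.assoc mult_minus_left)
  have d: "diag_odd f 2 = pure [f, uP] + pure [1, f]"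
    by (simp add: numeral_2_eq_2 tcat tunit_def)
  have sw: "swap_factors 1 (diag_odd f 2) = pure [uP, f] + pure [f, 1]"
    by (simp add: d swap_factors_lin swap_list_def)
  \<comment> \<open>The factor 4 clears the two coefficients 1/2; written as
    \<open>1 + 1 + 1 + 1\<close>, it unfolds into single terms that can be matched.\<close>
  have "tscale 4 (Rmat * swap_factors 1 (diag_odd f 2) * Rmat) =
    tscale (1 + 1 + 1 + 1) (diag_odd f 2)"
    unfolding sw unfolding Rmat_def d tv.scale_left_distrib
    by (simp add: tens_mult pure_mult_def algebra_simps PP Pf assms pure2_minus)
  then have "tscale (1/4) (tscale 4 (Rmat * swap_factors 1 (diag_odd f 2) * Rmat)) =
    tscale (1/4) (tscale 4 (diag_odd f 2))" by simp
  then show ?thesis by simp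
qed

text \<open>\<open>P \<otimes> P\<close> is symmetric and commutes with \<open>R\<close>, whose
  components are \<open>1\<close> and \<open>P\<close>; then \<open>R\<close> squares to the
  unit.\<close>

lemma Rmat_conj_Pstring: "Rmat * swap_factors 1 (Pstring 2) * Rmat = Pstring 2"
proof -
  have P: "Pstring 2 = pure [uP, uP]" by (simp add: numeral_2_eq_2)
  have "Rmat * pure [uP, uP] = pure [uP, uP] * Rmat"
    by (simp add: Rmat_def tens_mult pure_mult_def algebra_simps)
  moreover have "pure [uP, uP] \<in> tpow 2" by (simp add: pure_in_tpow)
  ultimately show ?thesis
    by (simp add: P swap_factors_lin swap_list_def mult.assoc Rmat_square tunit_mult)
qed

lemma gamma_gen_diag_odd:
  assumes "1 \<le> i" "i < n" and f: "uP * f = - (f * uP)"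
  shows "gamma_gen n i (diag_odd f n) = diag_odd f n"
proof -
  define a b where "a = i - 1" and "b = n - i - 1"
  have i: "i = Suc a" and n: "n = a + (2 + b)" using assms by (simp_all add: a_def b_def)
  have sw: "swap_factors 1 (tunit 2) = tunit 2"
    by (simp add: tunit_def swap_factors_lin swap_list_def numeral_2_eq_2)
  \<comment> \<open>The summands have \<open>f\<close> left of, inside, or right of the braided
    pair; on that pair \<open>P \<otimes> P\<close>, the diagonal \<open>f\<close> and the unit are
    each fixed.\<close>
  have "diag_odd f n = diag_odd f a \<otimes>\<^sub>t Pstring 2 \<otimes>\<^sub>t Pstring b
      + (tunit a \<otimes>\<^sub>t diag_odd f 2 \<otimes>\<^sub>t Pstring b + tunit a \<otimes>\<^sub>t tunit 2 \<otimes>\<^sub>t diag_odd f b)"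
    by (simp only: n diag_odd_append replicate_add tcat(1-3))
  moreover have "Pstring i \<in> tpow i" for i by (simp add: pure_in_tpow)
  ultimately show ?thesis
    by (simp only: i gamma_gen_add gamma_gen_tcat[OF _ _ _ n] diag_odd_tpow tunit_tpow
        Rmat_conj_odd[OF f] Rmat_conj_Pstring sw tunit_mult[OF Rmat_tpow] Rmat_square)
qed

text \<open>Each letter acts by a multiplicative map fixing \<open>diag_odd f n\<close>. Membership
  in \<open>tpow n\<close> is carried along because \<open>gamma_gen_mult\<close> asks for
  it.\<close>

lemma gamma_word_invariant:
  assumes "set w \<subseteq> {1..<n}" "X \<in> tpow n"
    and "uP * f = - (f * uP)" "diag_odd f n * X = X * diag_odd f n"
  shows "gamma_word n w X \<in> tpow n \<and>
    diag_odd f n * gamma_word n w X = gamma_word n w X * diag_odd f n"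
  using assms(1)
proof (induction w)
  case Nil
  show ?case using assms by (simp add: gamma_word_def)
next
  case (Cons i w)
  let ?Y = "gamma_word n w X"
  have i: "1 \<le> i" "i < n" and Y: "?Y \<in> tpow n" "diag_odd f n * ?Y = ?Y * diag_odd f n"
    using Cons by auto
  have "diag_odd f n * gamma_gen n i ?Y = gamma_gen n i (diag_odd f n * ?Y)"
    by (simp add: gamma_gen_mult[OF i Y(1)] gamma_gen_diag_odd[OF i assms(3)])
  also have "\<dots> = gamma_gen n i ?Y * diag_odd f n"
    by (simp add: Y(2) gamma_gen_mult[OF i diag_odd_tpow] gamma_gen_diag_odd[OF i assms(3)])
  finally show ?case
    using gamma_gen_tpow[OF i Y(1)] by (simp add: gamma_word_def)
qed


section \<open>Adjacent transpositions generate the symmetric group\<close>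

lemma word_perm_append: "word_perm (v @ w) = word_perm v \<circ> word_perm w"
  by (induction v) (simp_all add: word_perm_def comp_assoc)

text \<open>Induction on \<open>b - a\<close>, through
  \<open>(a b) = s_a (a+1 b) s_a\<close>.\<close>

lemma ex_word_transpose:
  assumes "1 \<le> a" "a < b" "b \<le> n"
  shows "\<exists>w. set w \<subseteq> {1..<n} \<and> word_perm w = transpose a b"
  using assms
proof (induction "b - a" arbitrary: a)
  case (Suc d)
  have adj: "word_perm [a] = transpose a (Suc a)" "set [a] \<subseteq> {1..<n}"
    using Suc.prems by (auto simp: word_perm_def)
  show ?case
  proof (cases "b = Suc a")
    case True
    with adj show ?thesis by blast
  next
    case False
    then obtain w where w: "set w \<subseteq> {1..<n}" "word_perm w = transpose (Suc a) b"
      using Suc.hyps(1)[of "Suc a"] Suc.hyps(2) Suc.prems by force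
    have "transpose a b = transpose a (Suc a) \<circ> transpose (Suc a) b \<circ> transpose a (Suc a)"
      by (rule ext) (use False Suc.prems in \<open>simp add: transpose_def\<close>)
    then have "word_perm ([a] @ w @ [a]) = transpose a b"
      by (simp only: word_perm_append adj w comp_assoc)
    moreover have "set ([a] @ w @ [a]) \<subseteq> {1..<n}" using adj w by auto
    ultimately show ?thesis by blast
  qed
qed simp

text \<open>Ensures that the word selected in \<open>gamma\<close> meets its specification.\<close>

lemma ex_word_permutes:
  assumes "s permutes {1..n}"
  shows "\<exists>w. set w \<subseteq> {1..<n} \<and> word_perm w = s"
  using assms finite_atLeastAtMost
proof (induction rule: permutes_induct)
  case id
  have "word_perm [] = id" by (simp add: word_perm_def)
  then show ?case by (metis empty_set empty_subsetI)
next
  case (swap a b s)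
  then obtain v where v: "set v \<subseteq> {1..<n}" "word_perm v = s" by blast
  obtain w where w: "set w \<subseteq> {1..<n}" "word_perm w = transpose a b"
    using ex_word_transpose[of a b n] ex_word_transpose[of b a n] swap(1-3)
    by (cases a b rule: linorder_cases) (auto simp: transpose_commute)
  have "word_perm (w @ v) = transpose a b \<circ> s" "set (w @ v) \<subseteq> {1..<n}"
    using v w by (auto simp: word_perm_append)
  then show ?case by blast
qed

text \<open>An initial interval of length \<open>|A|\<close> works: glue a bijection onto
  \<open>A\<close> with one between the complements. This makes the choice in
  \<open>intermediate_casimir\<close> satisfiable.\<close>

lemma ex_permutes_image:
  fixes A :: "nat set"
  assumes "A \<subseteq> {1..n}" "A \<noteq> {}"
  shows "\<exists>k l s. 1 \<le> k \<and> k \<le> l \<and> l \<le> n \<and> card {k..l} = card A \<and>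
    s permutes {1..n} \<and> s ` {k..l} = A"
proof -
  let ?K = "{1..card A}"
  have fin: "finite A" using finite_subset[OF assms(1)] by simp
  then have c: "0 < card A" "card A \<le> n"
    using assms card_mono[OF _ assms(1)] by (auto simp: card_gt_0_iff)
  obtain f where f: "bij_betw f ?K A"
    using finite_same_card_bij[of ?K A] fin by auto
  obtain g where g: "bij_betw g ({1..n} - ?K) ({1..n} - A)"
    using finite_same_card_bij[of "{1..n} - ?K" "{1..n} - A"] assms(1) fin c
    by (auto simp: card_Diff_subset)
  define s where "s x = (if x \<in> {1..n} then if x \<in> ?K then f x else g x else x)" for x
  have sK: "bij_betw s ?K A"
    using f c by (subst bij_betw_cong[of _ _ f]) (auto simp: s_def)
  moreover have "bij_betw s ({1..n} - ?K) ({1..n} - A)"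
    using g by (subst bij_betw_cong[of _ _ g]) (auto simp: s_def)
  ultimately have "bij_betw s (?K \<union> ({1..n} - ?K)) (A \<union> ({1..n} - A))"
    by (rule bij_betw_combine) blast
  moreover have "?K \<union> ({1..n} - ?K) = {1..n}" "A \<union> ({1..n} - A) = {1..n}"
    using assms c by auto
  ultimately have "bij_betw s {1..n} {1..n}" by simp
  then have "s permutes {1..n}"
    by (rule bij_imp_permutes) (auto simp: s_def)
  then show ?thesis
    using c bij_betw_imp_surj_on[OF sK] by (intro exI[of _ 1] exI[of _ "card A"] exI[of _ s]) auto
qed


section \<open>The centralizer\<close>

lemma diag_centralizerI:
  assumes "0 < n" "X \<in> tpow n"
    "diag_odd uFp n * X = X * diag_odd uFp n" "diag_odd uFm n * X = X * diag_odd uFm n"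
  shows "X \<in> diag_centralizer n"
proof -
  define D where "D = iter_coprod (n - 1)"
  \<comment> \<open>\<open>Z\<close> is closed under sums, scalars and products, so it contains
    \<open>osp12\<close> once it contains \<open>F^+\<close> and \<open>F^-\<close>.\<close>
  define Z where "Z = {u. D u * X = X * D u}"
  have mult: "u * v \<in> Z" if "u \<in> Z" "v \<in> Z" for u v
    using that unfolding Z_def D_def by (simp add: iter_coprod_mult) (metis mult.assoc)
  have add: "u + v \<in> Z" if "u \<in> Z" "v \<in> Z" for u v
    using that by (simp add: Z_def D_def iter_coprod_add distrib_left distrib_right)
  have scale: "uscale c u \<in> Z" if "u \<in> Z" for c u
    using that by (simp add: Z_def D_def iter_coprod_scale tens_mult)
  have F: "uFp \<in> Z" "uFm \<in> Z"
    using assms iter_coprod_odd[of uFp "n - 1"] iter_coprod_odd[of uFm "n - 1"]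
    by (simp_all add: Z_def D_def coprod_hom)
  have "uH = uscale 2 (uFp * uFm + uFm * uFp)"
    using U_relations(6) by (simp add: anticommutator_def)
  moreover have "uEp = uscale 4 (uFp * uFp)" "uEm = uscale (-4) (uFm * uFm)"
    by (simp_all add: U_normal_order)
  ultimately have "{uFp, uFm, uH, uEp, uEm} \<subseteq> Z"
    by (metis F add bot.extremum insert_subset mult scale)
  moreover have "uv.subspace Z"
    by (rule uv.subspaceI) (use add scale scale[OF F(1), of 0] in auto)
  ultimately have "osp12 \<subseteq> Z"
    unfolding osp12_def by (rule uv.span_minimal)
  then show ?thesis
    using assms(2) by (auto simp: diag_centralizer_def commutator_def Z_def D_def)
qed

theorem mainTheorem3:
  fixes n :: nat and A :: "nat set"
  assumes "0 < n" and "A \<subseteq> {1..n}"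
  shows "intermediate_casimir n A \<in> diag_centralizer n"
proof (cases "A = {}")
  case True
  then show ?thesis
    using assms by (simp add: intermediate_casimir_def diag_centralizerI tunit_tpow tunit_mult diag_odd_tpow)
next
  case False
  \<comment> \<open>Existence lets the chosen element be unpacked into some interval and permutation
    describing \<open>A\<close>.\<close>
  then have "\<exists>X k l s. 1 \<le> k \<and> k \<le> l \<and> l \<le> n \<and> card {k..l} = card A \<and>
       s permutes {1..n} \<and> s ` {k..l} = A \<and> X = gamma n s (interval_casimir n k l)"
    using ex_permutes_image[OF assms(2)] by blast
  from someI_ex[OF this] False obtain k l s where
    kl: "1 \<le> k" "k \<le> l" "l \<le> n" and s: "s permutes {1..n}"
    and X: "intermediate_casimir n A = gamma n s (interval_casimir n k l)"
    unfolding intermediate_casimir_def by auto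
  define w where "w = (SOME w. set w \<subseteq> {1..<n} \<and> word_perm w = s)"
  have w: "set w \<subseteq> {1..<n}"
    using someI_ex[OF ex_word_permutes[OF s]] by (simp add: w_def)
  note inv = gamma_word_invariant[OF w interval_casimir_tpow[OF kl] _ interval_casimir_diag_odd[OF kl]]
  show ?thesis
    unfolding X gamma_def w_def[symmetric]
    using inv[of uFp] inv[of uFm]
    by (intro diag_centralizerI assms) (simp_all add: U_normal_order casimir_commute coprod_hom)
qed

end
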